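(* Let $X$ be a non-empty set and let $A$ be a unital subalgebra of $\ell^{\infty}(X)$, equipped with the norm $\|f\|_X=\sup_{x\in X}|f(x)|$. Then every $\|\cdot\|_X$-continuous positive linear functional $L:A\to\mathbb{R}$ admits an integral representation with respect to a unique Radon measure $\mu$ on the Gelfand spectrum $\mathfrak{sp}_{\|\cdot\|_X}(A)$ of $(A,\|\cdot\|_X)$, i.e. there is a unique Radon measure $\mu$ on $\mathfrak{sp}_{\|\cdot\|_X}(A)$ such that $$L(a)=\int_{\mathfrak{sp}_{\|\cdot\|_X}(A)}\hat a\,d\mu\qquad\text{for all } a\in A.$$
   Context: $\ell^{\infty}(X)$ is the algebra of all bounded functions $X\to\mathbb{R}$ with pointwise operations. A linear functional $L:A\to\mathbb{R}$ is positive if $L(f)\ge0$ for every $f\in A$ with $f(x)\ge0$ for all $x\in X$. The Gelfand spectrum $\mathfrak{sp}_{\|\cdot\|_X}(A)$ is the set of all $\|\cdot\|_X$-continuous real-valued (unital) $\mathbb{R}$-algebra homomorphisms $\alpha:A\to\mathbb{R}$, with the topology of pointwise convergence on $A$ (it is compact and Hausdorff); for $a\in A$, $\hat a:\mathfrak{sp}_{\|\cdot\|_X}(A)\to\mathbb{R}$ is the continuous function $\hat a(\alpha)=\alpha(a)$. Radon measures are positive. *)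

theory Defs
  imports "HOL-Analysis.Analysis"
begin

text \<open>
  Functions on a set \<open>X\<close> are represented by extensional functions (\<open>undefined\<close> outside the set),
  so that equality of the representing HOL functions is equality as functions on \<open>X\<close>.
  The same convention is used for characters, which are functions on an algebra \<open>A\<close>.
\<close>

definition linf :: "'x set \<Rightarrow> ('x \<Rightarrow> real) set" where
  "linf X = {f \<in> X \<rightarrow>\<^sub>E UNIV. bounded (f ` X)}"

text \<open>
  The value \<open>0\<close> for functions outside \<open>linf X\<close> is never relevant; it only makes \<open>sup_dist\<close>
  non-negative everywhere, as the library locale \<open>Metric_space\<close> requires.
\<close>

definition sup_norm :: "'x set \<Rightarrow> ('x \<Rightarrow> real) \<Rightarrow> real" where
  "sup_norm X f = (if f \<in> linf X then SUP x\<in>X. \<bar>f x\<bar> else 0)"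

definition sup_dist :: "'x set \<Rightarrow> ('x \<Rightarrow> real) \<Rightarrow> ('x \<Rightarrow> real) \<Rightarrow> real" where
  "sup_dist X f g = sup_norm X (\<lambda>x\<in>X. f x - g x)"

definition sup_topology :: "'x set \<Rightarrow> ('x \<Rightarrow> real) set \<Rightarrow> ('x \<Rightarrow> real) topology" where
  "sup_topology X A = Metric_space.mtopology A (sup_dist X)"

definition unital_subalgebra :: "'x set \<Rightarrow> ('x \<Rightarrow> real) set \<Rightarrow> bool" where
  "unital_subalgebra X A \<longleftrightarrow>
     A \<subseteq> linf X \<and>
     (\<lambda>x\<in>X. 1) \<in> A \<and>
     (\<forall>f\<in>A. \<forall>g\<in>A. (\<lambda>x\<in>X. f x + g x) \<in> A) \<and>
     (\<forall>c. \<forall>f\<in>A. (\<lambda>x\<in>X. c * f x) \<in> A) \<and>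
     (\<forall>f\<in>A. \<forall>g\<in>A. (\<lambda>x\<in>X. f x * g x) \<in> A)"

definition linear_functional ::
  "'x set \<Rightarrow> ('x \<Rightarrow> real) set \<Rightarrow> (('x \<Rightarrow> real) \<Rightarrow> real) \<Rightarrow> bool" where
  "linear_functional X A L \<longleftrightarrow>
     (\<forall>f\<in>A. \<forall>g\<in>A. L (\<lambda>x\<in>X. f x + g x) = L f + L g) \<and>
     (\<forall>c. \<forall>f\<in>A. L (\<lambda>x\<in>X. c * f x) = c * L f)"

definition positive_functional ::
  "'x set \<Rightarrow> ('x \<Rightarrow> real) set \<Rightarrow> (('x \<Rightarrow> real) \<Rightarrow> real) \<Rightarrow> bool" where
  "positive_functional X A L \<longleftrightarrow> (\<forall>f\<in>A. (\<forall>x\<in>X. 0 \<le> f x) \<longrightarrow> 0 \<le> L f)"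

definition unital_algebra_hom ::
  "'x set \<Rightarrow> ('x \<Rightarrow> real) set \<Rightarrow> (('x \<Rightarrow> real) \<Rightarrow> real) \<Rightarrow> bool" where
  "unital_algebra_hom X A \<alpha> \<longleftrightarrow>
     linear_functional X A \<alpha> \<and>
     (\<forall>f\<in>A. \<forall>g\<in>A. \<alpha> (\<lambda>x\<in>X. f x * g x) = \<alpha> f * \<alpha> g) \<and>
     \<alpha> (\<lambda>x\<in>X. 1) = 1"

definition gelfand_spectrum ::
  "'x set \<Rightarrow> ('x \<Rightarrow> real) set \<Rightarrow> (('x \<Rightarrow> real) \<Rightarrow> real) set" where
  "gelfand_spectrum X A =
     {\<alpha> \<in> A \<rightarrow>\<^sub>E UNIV. unital_algebra_hom X A \<alpha> \<and>
        continuous_map (sup_topology X A) euclideanreal \<alpha>}"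

text \<open>The product topology over the index set \<open>A\<close> is pointwise convergence on \<open>A\<close>.\<close>

definition gelfand_topology ::
  "'x set \<Rightarrow> ('x \<Rightarrow> real) set \<Rightarrow> (('x \<Rightarrow> real) \<Rightarrow> real) topology" where
  "gelfand_topology X A =
     subtopology (product_topology (\<lambda>_. euclideanreal) A) (gelfand_spectrum X A)"

definition gelfand_transform ::
  "('x \<Rightarrow> real) \<Rightarrow> (('x \<Rightarrow> real) \<Rightarrow> real) \<Rightarrow> real" where
  "gelfand_transform a \<alpha> = \<alpha> a"

text \<open>
  A Radon measure on a Hausdorff space is a Borel measure that is locally finite and inner
  regular with respect to compact sets. Compact sets are closed in a Hausdorff space, so every
  set in the supremum below is measurable.
\<close>

definition radon_measure :: "'a topology \<Rightarrow> 'a measure \<Rightarrow> bool" where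
  "radon_measure T M \<longleftrightarrow>
     sets M = sets (sigma (topspace T) {U. openin T U}) \<and>
     (\<forall>x\<in>topspace T. \<exists>U. openin T U \<and> x \<in> U \<and> emeasure M U < \<infinity>) \<and>
     (\<forall>B\<in>sets M. emeasure M B = (SUP K\<in>{K. compactin T K \<and> K \<subseteq> B}. emeasure M K))"

text \<open>
  The constant \<open>Metric_space.mtopology\<close> in \<open>sup_topology\<close> has its intended meaning because the
  sup distance is a metric on every set of bounded functions on a non-empty set.
\<close>

lemma Metric_space_sup_dist:
  assumes X: "X \<noteq> {}" and A: "A \<subseteq> linf X"
  shows "Metric_space A (sup_dist X)"
proof -
  have diff: "(\<lambda>x\<in>X. f x - g x) \<in> linf X" if "f \<in> linf X" "g \<in> linf X" for f g
    using that bounded_minus_comp[of f X g] by (simp add: linf_def)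
  have bdd: "bdd_above ((\<lambda>x. \<bar>f x\<bar>) ` X)" if "f \<in> linf X" for f
    using that by (auto simp: linf_def bounded_iff bdd_above_def)
  have up: "\<bar>f x\<bar> \<le> sup_norm X f" if "f \<in> linf X" "x \<in> X" for f x
    using bdd[OF that(1)] that by (auto simp: sup_norm_def intro: cSUP_upper)
  have up2: "\<bar>f x - g x\<bar> \<le> sup_dist X f g" if "f \<in> A" "g \<in> A" "x \<in> X" for f g x
    using up[OF diff[of f g] that(3)] that A by (auto simp: sup_dist_def)
  have nonneg: "0 \<le> sup_norm X f" for f
  proof (cases "f \<in> linf X")
    case True
    then show ?thesis using up[OF True] X by (meson abs_ge_zero all_not_in_conv order_trans)
  qed (simp add: sup_norm_def)
  have mem: "(\<lambda>x\<in>X. f x - g x) \<in> linf X \<longleftrightarrow> (\<lambda>x\<in>X. g x - f x) \<in> linf X"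
    for f g :: "'a \<Rightarrow> real"
    by (simp add: linf_def bounded_iff abs_minus_commute)
  show ?thesis
  proof
    fix f g :: "'a \<Rightarrow> real"
    show "0 \<le> sup_dist X f g" by (simp add: sup_dist_def nonneg)
    show "sup_dist X f g = sup_dist X g f"
      using mem[of f g] by (simp add: sup_dist_def sup_norm_def abs_minus_commute)
  next
    fix f g assume fg: "f \<in> A" "g \<in> A"
    show "sup_dist X f g = 0 \<longleftrightarrow> f = g"
    proof
      assume "sup_dist X f g = 0"
      then have "f x = g x" if "x \<in> X" for x
        using up2[OF fg that] by simp
      then show "f = g"
        using fg A by (intro extensionalityI[of f X g]) (auto simp: linf_def PiE_def)
    qed (use X in \<open>simp add: sup_dist_def sup_norm_def\<close>)
  next
    fix f g h assume fgh: "f \<in> A" "g \<in> A" "h \<in> A"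
    have "sup_dist X f h = (SUP x\<in>X. \<bar>f x - h x\<bar>)"
      using diff[of f h] fgh A by (auto simp: sup_dist_def sup_norm_def)
    also have "\<dots> \<le> sup_dist X f g + sup_dist X g h"
    proof (rule cSUP_least[OF X])
      fix x assume "x \<in> X"
      then show "\<bar>f x - h x\<bar> \<le> sup_dist X f g + sup_dist X g h"
        using up2[OF fgh(1,2)] up2[OF fgh(2,3)] by (smt (verit))
    qed
    finally show "sup_dist X f h \<le> sup_dist X f g + sup_dist X g h" .
  qed
qed

end

theory Submission
  imports Defs
begin

text \<open>
  The spectrum is a compact Hausdorff space, and by the Stone--Weierstrass theorem the transforms
  \<open>\<alpha> \<mapsto> \<alpha> a\<close> are uniformly dense in its continuous functions. Every point of \<open>X\<close> gives an
  evaluation character, so \<open>a\<close> is determined by its transform, and \<open>a \<ge> 0\<close> whenever the transform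
  is; hence \<open>L\<close> becomes a positive functional on the transforms. Such a functional \<open>\<Lambda>\<close> on a dense
  subspace is represented as in the Riesz--Markov theorem, without first extending it to all
  continuous functions: an open set \<open>U\<close> gets the content \<open>sup {\<Lambda> g | g \<le> 1\<^sub>U}\<close>, and the outer measure
  induced by this content is restricted to the Borel sets by Caratheodory's theorem. A Radon
  measure representing \<open>\<Lambda>\<close> must agree with this content on the open sets, which gives uniqueness.
\<close>

section \<open>Separation axioms for function spaces\<close>

text \<open>The library has these instances only for countable products of metric spaces; they have to
  be generalised one class at a time to keep the type arities coregular.\<close>

instance "fun" :: (type, t0_space) t0_space
proof
  fix f g :: "'a \<Rightarrow> 'b"
  assume "f \<noteq> g"
  then obtain x where "f x \<noteq> g x" by auto
  then obtain U where U: "open U" "\<not> (f x \<in> U \<longleftrightarrow> g x \<in> U)"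
    using t0_space_class.t0_space by metis
  then show "\<exists>U. open U \<and> \<not> (f \<in> U \<longleftrightarrow> g \<in> U)"
    using continuous_on_product_coordinates[of x, where 'b='b]
    by (intro exI[of _ "(\<lambda>h. h x) -` U"]) (auto intro: open_vimage)
qed

instance "fun" :: (type, t1_space) t1_space
proof
  fix f g :: "'a \<Rightarrow> 'b"
  assume "f \<noteq> g"
  then obtain x where "f x \<noteq> g x" by auto
  then obtain U where "open U" "f x \<in> U" "g x \<notin> U"
    using t1_space by metis
  then show "\<exists>U. open U \<and> f \<in> U \<and> g \<notin> U"
    using continuous_on_product_coordinates[of x, where 'b='b]
    by (intro exI[of _ "(\<lambda>h. h x) -` U"]) (auto intro: open_vimage)
qed

instance "fun" :: (type, t2_space) t2_space
proof
  fix f g :: "'a \<Rightarrow> 'b"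
  assume "f \<noteq> g"
  then obtain x where "f x \<noteq> g x" by auto
  then obtain U V where "open U" "open V" "f x \<in> U" "g x \<in> V" "U \<inter> V = {}"
    using hausdorff by metis
  then show "\<exists>U V. open U \<and> open V \<and> f \<in> U \<and> g \<in> V \<and> U \<inter> V = {}"
    using continuous_on_product_coordinates[of x, where 'b='b]
    by (intro exI[of _ "(\<lambda>h. h x) -` U"] exI[of _ "(\<lambda>h. h x) -` V"]) (auto intro: open_vimage)
qed

section \<open>Riesz representation on a dense subspace\<close>

lemma level_subset:
  fixes f :: "'b \<Rightarrow> real"
  assumes "0 < d" "\<And>x. x \<in> S \<Longrightarrow> f x \<le> indicator U x"
  shows "{x \<in> S. d \<le> f x} \<subseteq> U"
proof
  fix x assume "x \<in> {x \<in> S. d \<le> f x}"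
  then have "0 < (indicator U x :: real)" using assms(1) assms(2)[of x] by simp
  then show "x \<in> U" by (simp add: indicator_def split: if_splits)
qed

definition layer :: "real \<Rightarrow> real \<Rightarrow> nat \<Rightarrow> real" where
  "layer d y k = min (max (y - real k * d) 0) d"

lemma sum_layer:
  assumes "0 \<le> y" "0 < d"
  shows "(\<Sum>k<n. layer d y k) = min y (real n * d)"
proof (induction n)
  case (Suc n)
  have "real (Suc n) * d = real n * d + d" by (simp add: algebra_simps)
  with Suc assms show ?case by (auto simp: layer_def min_def max_def)
qed (use assms in simp)

lemma sum_indicator_levels:
  fixes y d :: real
  assumes "0 \<le> y" "0 < d"
  shows "(\<Sum>k<n. d * of_bool (real k * d < y)) \<le> min (real n * d) (y + d)"
proof (induction n)
  case (Suc n)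
  have "real (Suc n) * d = real n * d + d" by (simp add: algebra_simps)
  with Suc assms show ?case by (cases "real n * d < y") auto
qed (use assms in simp)

locale dense_positive_functional =
  fixes T :: "'a topology" and R :: "('a \<Rightarrow> real) set" and \<Lambda> :: "('a \<Rightarrow> real) \<Rightarrow> real"
  assumes compact_T: "compact_space T"
    and Hausdorff_T: "Hausdorff_space T"
    and continuous_R: "f \<in> R \<Longrightarrow> continuous_map T euclideanreal f"
    and const_R: "(\<lambda>_. c) \<in> R"
    and add_R: "f \<in> R \<Longrightarrow> g \<in> R \<Longrightarrow> (\<lambda>x. f x + g x) \<in> R"
    and scale_R: "f \<in> R \<Longrightarrow> (\<lambda>x. c * f x) \<in> R"
    and dense_R: "continuous_map T euclideanreal f \<Longrightarrow> 0 < e \<Longrightarrow>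
      \<exists>g\<in>R. \<forall>x\<in>topspace T. \<bar>f x - g x\<bar> < e"
    and \<Lambda>_add: "f \<in> R \<Longrightarrow> g \<in> R \<Longrightarrow> \<Lambda> (\<lambda>x. f x + g x) = \<Lambda> f + \<Lambda> g"
    and \<Lambda>_scale: "f \<in> R \<Longrightarrow> \<Lambda> (\<lambda>x. c * f x) = c * \<Lambda> f"
    and \<Lambda>_nonneg: "f \<in> R \<Longrightarrow> (\<And>x. x \<in> topspace T \<Longrightarrow> 0 \<le> f x) \<Longrightarrow> 0 \<le> \<Lambda> f"
begin

definition mass :: real where "mass = \<Lambda> (\<lambda>_. 1)"

lemma mass_nonneg: "0 \<le> mass"
  unfolding mass_def by (rule \<Lambda>_nonneg) (auto simp: const_R)

lemma \<Lambda>_const: "\<Lambda> (\<lambda>_. c) = c * mass"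
  using \<Lambda>_scale[OF const_R[of 1], of c] by (simp add: mass_def)

lemma \<Lambda>_mono:
  assumes "f \<in> R" "g \<in> R" "\<And>x. x \<in> topspace T \<Longrightarrow> f x \<le> g x"
  shows "\<Lambda> f \<le> \<Lambda> g"
proof -
  have "0 \<le> \<Lambda> (\<lambda>x. g x + (-1) * f x)"
    using assms by (intro \<Lambda>_nonneg add_R scale_R) auto
  also have "\<dots> = \<Lambda> g + (-1) * \<Lambda> f"
    using assms by (simp only: \<Lambda>_add \<Lambda>_scale scale_R)
  finally show ?thesis by simp
qed

lemma continuous_map_bounded:
  assumes "continuous_map T euclideanreal f"
  obtains b where "0 < b" "\<And>x. x \<in> topspace T \<Longrightarrow> \<bar>f x\<bar> \<le> b"
proof -
  have "compact (f ` topspace T)"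
    using assms compact_T image_compactin[of T "topspace T" euclideanreal f]
    by (simp add: compact_space_def)
  then show ?thesis
    using that by (auto simp: bounded_pos dest!: compact_imp_bounded)
qed

definition lower :: "('a \<Rightarrow> real) \<Rightarrow> real" where
  "lower f = (SUP g\<in>{g \<in> R. \<forall>x\<in>topspace T. g x \<le> f x}. \<Lambda> g)"

lemma lower_ge:
  assumes "g \<in> R" "\<And>x. x \<in> topspace T \<Longrightarrow> g x \<le> f x" "\<And>x. x \<in> topspace T \<Longrightarrow> f x \<le> b"
  shows "\<Lambda> g \<le> lower f"
proof -
  have "\<Lambda> h \<le> \<Lambda> (\<lambda>_. b)" if "h \<in> R" "\<forall>x\<in>topspace T. h x \<le> f x" for h
    using that assms by (intro \<Lambda>_mono const_R) force+
  then have "bdd_above (\<Lambda> ` {g \<in> R. \<forall>x\<in>topspace T. g x \<le> f x})"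
    by (auto simp: bdd_above_def)
  then show ?thesis
    unfolding lower_def using assms by (intro cSUP_upper) auto
qed

lemma lower_le:
  assumes "\<And>x. x \<in> topspace T \<Longrightarrow> b \<le> f x"
    and "\<And>g. g \<in> R \<Longrightarrow> (\<And>x. x \<in> topspace T \<Longrightarrow> g x \<le> f x) \<Longrightarrow> \<Lambda> g \<le> c"
  shows "lower f \<le> c"
  unfolding lower_def
proof (rule cSUP_least)
  have "(\<lambda>_. b) \<in> {g \<in> R. \<forall>x\<in>topspace T. g x \<le> f x}"
    using assms(1) const_R by auto
  then show "{g \<in> R. \<forall>x\<in>topspace T. g x \<le> f x} \<noteq> {}" by blast
qed (use assms(2) in auto)

lemma lower_eq_\<Lambda>:
  assumes "f \<in> R"
  shows "lower f = \<Lambda> f"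
proof -
  obtain b where b: "\<And>x. x \<in> topspace T \<Longrightarrow> \<bar>f x\<bar> \<le> b"
    using continuous_map_bounded[OF continuous_R[OF assms]] by metis
  have "lower f \<le> \<Lambda> f"
  proof (rule lower_le)
    show "- b \<le> f x" if "x \<in> topspace T" for x using b[OF that] by linarith
  qed (use assms \<Lambda>_mono in auto)
  moreover have "\<Lambda> f \<le> lower f"
  proof (rule lower_ge)
    show "f x \<le> b" if "x \<in> topspace T" for x using b[OF that] by linarith
  qed (use assms in auto)
  ultimately show ?thesis by simp
qed

lemma approx_below:
  assumes "continuous_map T euclideanreal f" "0 < e"
  obtains g where "g \<in> R" "\<And>x. x \<in> topspace T \<Longrightarrow> g x \<le> f x"
    "\<And>x. x \<in> topspace T \<Longrightarrow> f x \<le> g x + e"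
proof -
  obtain g where g: "g \<in> R" "\<And>x. x \<in> topspace T \<Longrightarrow> \<bar>f x - g x\<bar> < e / 2"
    using dense_R[OF assms(1), of "e / 2"] assms(2) by auto
  show ?thesis
  proof
    show "(\<lambda>x. g x + - e / 2) \<in> R" by (intro add_R g const_R)
    show "g x + - e / 2 \<le> f x" "f x \<le> g x + - e / 2 + e" if "x \<in> topspace T" for x
      using g(2)[OF that] by (auto simp: abs_if split: if_splits)
  qed
qed

lemma lower_add:
  assumes f: "continuous_map T euclideanreal f" and g: "continuous_map T euclideanreal g"
  shows "lower (\<lambda>x. f x + g x) \<le> lower f + lower g"
proof -
  obtain b where b: "\<And>x. x \<in> topspace T \<Longrightarrow> \<bar>f x\<bar> \<le> b"
    using continuous_map_bounded[OF f] by metis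
  obtain c where c: "\<And>x. x \<in> topspace T \<Longrightarrow> \<bar>g x\<bar> \<le> c"
    using continuous_map_bounded[OF g] by metis
  show ?thesis
  proof (rule lower_le)
    fix x assume "x \<in> topspace T"
    then show "- b - c \<le> f x + g x" using b[of x] c[of x] by linarith
  next
    fix h assume h: "h \<in> R" "\<And>x. x \<in> topspace T \<Longrightarrow> h x \<le> f x + g x"
    show "\<Lambda> h \<le> lower f + lower g"
    proof (rule field_le_epsilon)
      fix e :: real assume "0 < e"
      define d where "d = e / (2 * (mass + 1))"
      have d: "0 < d" "2 * d * mass \<le> e"
        using \<open>0 < e\<close> mass_nonneg by (auto simp: d_def field_simps)
      obtain f' where f': "f' \<in> R" "\<And>x. x \<in> topspace T \<Longrightarrow> f' x \<le> f x"
          "\<And>x. x \<in> topspace T \<Longrightarrow> f x \<le> f' x + d"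
        using approx_below[OF f d(1)] by metis
      obtain g' where g': "g' \<in> R" "\<And>x. x \<in> topspace T \<Longrightarrow> g' x \<le> g x"
          "\<And>x. x \<in> topspace T \<Longrightarrow> g x \<le> g' x + d"
        using approx_below[OF g d(1)] by metis
      have "\<Lambda> h \<le> \<Lambda> (\<lambda>x. (f' x + g' x) + 2 * d)"
      proof (intro \<Lambda>_mono add_R const_R h f' g')
        fix x assume "x \<in> topspace T"
        then show "h x \<le> f' x + g' x + 2 * d"
          using h(2)[of x] f'(3)[of x] g'(3)[of x] by linarith
      qed
      also have "\<dots> = \<Lambda> f' + \<Lambda> g' + 2 * d * mass"
        by (simp only: \<Lambda>_add \<Lambda>_const add_R const_R f' g')
      also have "\<dots> \<le> lower f + lower g + e"
      proof (intro add_mono d)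
        show "\<Lambda> f' \<le> lower f" using f' b by (intro lower_ge[of f' f b]) fastforce+
        show "\<Lambda> g' \<le> lower g" using g' c by (intro lower_ge[of g' g c]) fastforce+
      qed
      finally show "\<Lambda> h \<le> lower f + lower g + e" .
    qed
  qed
qed

lemma lower_sum:
  assumes "finite I" "\<And>i. i \<in> I \<Longrightarrow> continuous_map T euclideanreal (f i)"
  shows "lower (\<lambda>x. \<Sum>i\<in>I. f i x) \<le> (\<Sum>i\<in>I. lower (f i))"
  using assms
proof (induction I rule: finite_induct)
  case empty
  then show ?case using lower_eq_\<Lambda>[OF const_R[of 0]] \<Lambda>_const[of 0] by simp
next
  case (insert i I)
  have "lower (\<lambda>x. f i x + (\<Sum>i\<in>I. f i x)) \<le> lower (f i) + lower (\<lambda>x. \<Sum>i\<in>I. f i x)"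
    using insert by (intro lower_add continuous_map_sum) auto
  with insert show ?case by simp
qed

lemma lower_mono:
  assumes "\<And>x. x \<in> topspace T \<Longrightarrow> b \<le> f x" "\<And>x. x \<in> topspace T \<Longrightarrow> f x \<le> g x"
    "\<And>x. x \<in> topspace T \<Longrightarrow> g x \<le> c"
  shows "lower f \<le> lower g"
  using assms by (intro lower_le[of b] lower_ge[of _ _ c]) force+

definition content :: "'a set \<Rightarrow> real" where "content U = lower (indicator U)"

lemma content_ge:
  assumes "g \<in> R" "\<And>x. x \<in> topspace T \<Longrightarrow> g x \<le> indicator U x"
  shows "\<Lambda> g \<le> content U"
  unfolding content_def by (rule lower_ge[OF assms, of 1]) (auto simp: indicator_def)

lemma content_le:
  assumes "\<And>g. g \<in> R \<Longrightarrow> (\<And>x. x \<in> topspace T \<Longrightarrow> g x \<le> indicator U x) \<Longrightarrow> \<Lambda> g \<le> c"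
  shows "content U \<le> c"
  unfolding content_def by (rule lower_le[of 0]) (use assms in \<open>auto simp: indicator_def\<close>)

lemma content_nonneg: "0 \<le> content U"
  using content_ge[OF const_R[of 0], of U] \<Lambda>_const[of 0] by simp

lemma content_mono: "U \<subseteq> V \<Longrightarrow> content U \<le> content V"
  unfolding content_def by (rule lower_mono[of 0 _ _ 1]) (auto simp: indicator_def)

lemma content_empty: "content {} = 0"
proof (rule antisym[OF content_le content_nonneg])
  fix g assume "g \<in> R" "\<And>x. x \<in> topspace T \<Longrightarrow> g x \<le> indicator {} x"
  then have "\<Lambda> g \<le> \<Lambda> (\<lambda>_. 0)" by (intro \<Lambda>_mono const_R) auto
  then show "\<Lambda> g \<le> 0" by (simp add: \<Lambda>_const[of 0])
qed

lemma content_topspace: "content (topspace T) = mass"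
proof (rule antisym)
  show "content (topspace T) \<le> mass"
    unfolding mass_def by (rule content_le) (auto intro!: \<Lambda>_mono const_R)
  show "mass \<le> content (topspace T)"
    unfolding mass_def by (rule content_ge) (auto simp: const_R)
qed

lemma closedin_level:
  assumes "continuous_map T euclideanreal f"
  shows "closedin T {x \<in> topspace T. e \<le> f x}"
  using closedin_continuous_map_preimage[OF assms, of "{e..}"] by simp

lemma openin_level:
  assumes "continuous_map T euclideanreal f"
  shows "openin T {x \<in> topspace T. e < f x}"
  using openin_continuous_map_preimage[OF assms, of "{e<..}"] by simp

lemma Urysohn_T:
  assumes "closedin T C" "closedin T D" "C \<inter> D = {}"
  obtains f where "continuous_map T euclideanreal f" "\<And>x. x \<in> topspace T \<Longrightarrow> f x \<in> {0..1}"
    "\<And>x. x \<in> C \<Longrightarrow> f x = (0::real)" "\<And>x. x \<in> D \<Longrightarrow> f x = 1"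
proof -
  have "normal_space T"
    using compact_T Hausdorff_T by (simp add: compact_Hausdorff_or_regular_imp_normal_space)
  then obtain f where "continuous_map T (top_of_set {0..1::real}) f" "f ` C \<subseteq> {0}" "f ` D \<subseteq> {1}"
    using Urysohn_lemma[of T C D 0 1] assms by (auto simp: disjnt_def)
  then show ?thesis
    by (intro that[of f]) (auto simp: continuous_map_in_subtopology)
qed

text \<open>For \<open>f \<le> indicator (U \<union> V)\<close>, a Urysohn function separating \<open>K - U\<close> from \<open>K - V\<close> with
  \<open>K = {d \<le> f}\<close> splits the positive part of \<open>f - d\<close> into summands below \<open>indicator U\<close> and
  \<open>indicator V\<close>.\<close>

lemma content_Un:
  assumes "openin T U" "openin T V"
  shows "content (U \<union> V) \<le> content U + content V"
proof (rule content_le)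
  fix f assume f: "f \<in> R" "\<And>x. x \<in> topspace T \<Longrightarrow> f x \<le> indicator (U \<union> V) x"
  have cf: "continuous_map T euclideanreal f" using f continuous_R by auto
  show "\<Lambda> f \<le> content U + content V"
  proof (rule field_le_epsilon)
    fix e :: real assume "0 < e"
    define d where "d = e / (mass + 1)"
    have d: "0 < d" "d * mass \<le> e"
      using \<open>0 < e\<close> mass_nonneg by (auto simp: d_def field_simps)
    define K where "K = {x \<in> topspace T. d \<le> f x}"
    have K: "closedin T K" unfolding K_def by (rule closedin_level[OF cf])
    have KUV: "K \<subseteq> U \<union> V"
      unfolding K_def using d(1) f(2) by (rule level_subset)
    obtain \<phi> where \<phi>: "continuous_map T euclideanreal \<phi>"
      "\<And>x. x \<in> topspace T \<Longrightarrow> \<phi> x \<in> {0..1}"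
      "\<And>x. x \<in> K - U \<Longrightarrow> \<phi> x = (0::real)" "\<And>x. x \<in> K - V \<Longrightarrow> \<phi> x = 1"
      using Urysohn_T[of "K - U" "K - V"] KUV K assms by (auto intro: closedin_diff)
    define g where "g x = \<phi> x * max (f x - d) 0" for x
    define h where "h x = (1 - \<phi> x) * max (f x - d) 0" for x
    have cg: "continuous_map T euclideanreal g" and ch: "continuous_map T euclideanreal h"
      unfolding g_def h_def
      by (intro continuous_map_real_mult continuous_map_real_max continuous_map_diff
          continuous_map_const[THEN iffD2] \<phi> cf; simp)+
    have m: "0 \<le> max (f x - d) 0" "max (f x - d) 0 \<le> 1" if "x \<in> topspace T" for x
      using order_trans[OF f(2)[OF that] indicator_le_1] d(1) by auto
    have gU: "0 \<le> g x \<and> g x \<le> indicator U x" if x: "x \<in> topspace T" for x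
    proof (cases "x \<in> K - U")
      case True
      then show ?thesis using \<phi>(3) by (auto simp: g_def)
    next
      case False
      then show ?thesis
        using m[OF x] \<phi>(2)[OF x] x mult_mono[of "\<phi> x" 1 "max (f x - d) 0" 1]
        by (cases "x \<in> U") (auto simp: g_def K_def max_def)
    qed
    have hV: "0 \<le> h x \<and> h x \<le> indicator V x" if x: "x \<in> topspace T" for x
    proof (cases "x \<in> K - V")
      case True
      then show ?thesis using \<phi>(4) by (auto simp: h_def)
    next
      case False
      then show ?thesis
        using m[OF x] \<phi>(2)[OF x] x mult_mono[of "1 - \<phi> x" 1 "max (f x - d) 0" 1]
        by (cases "x \<in> V") (auto simp: h_def K_def max_def)
    qed
    have fd: "(\<lambda>x. f x + - d) \<in> R" by (intro add_R f const_R)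
    have "\<Lambda> f - d * mass = \<Lambda> (\<lambda>x. f x + - d)"
      using \<Lambda>_add[OF f(1) const_R[of "- d"]] \<Lambda>_const[of "- d"] by simp
    also have "\<dots> \<le> lower (\<lambda>x. g x + h x)"
    proof (rule lower_ge[OF fd])
      fix x assume x: "x \<in> topspace T"
      have "g x + h x = max (f x - d) 0" by (simp add: g_def h_def algebra_simps)
      then show "f x + - d \<le> g x + h x" "g x + h x \<le> 1" using m[OF x] by auto
    qed
    also have "\<dots> \<le> lower g + lower h" by (rule lower_add[OF cg ch])
    also have "\<dots> \<le> content U + content V"
      unfolding content_def using gU hV
      by (intro add_mono lower_mono[of 0 _ _ 1]) (auto simp: indicator_def)
    finally show "\<Lambda> f \<le> content U + content V + e" using d by linarith
  qed
qed

lemma content_finite_Union: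
  fixes U :: "nat \<Rightarrow> 'a set"
  assumes "\<And>i. openin T (U i)"
  shows "content (\<Union>i<n. U i) \<le> (\<Sum>i<n. content (U i))"
proof (induction n)
  case 0
  then show ?case by (simp add: content_empty)
next
  case (Suc n)
  have "content (\<Union>i<Suc n. U i) = content ((\<Union>i<n. U i) \<union> U n)"
    by (simp add: lessThan_Suc Un_commute)
  also have "\<dots> \<le> content (\<Union>i<n. U i) + content (U n)"
    using assms by (intro content_Un openin_Union) auto
  finally show ?case using Suc by simp
qed

lemma content_countable_Union:
  fixes U :: "nat \<Rightarrow> 'a set"
  assumes U: "\<And>i. openin T (U i)"
  shows "ennreal (content (\<Union>i. U i)) \<le> (\<Sum>i. ennreal (content (U i)))"
proof (cases "(\<Sum>i. ennreal (content (U i)))" rule: ennreal_cases)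
  case (real r)
  have sum_le: "(\<Sum>i<n. content (U i)) \<le> r" for n
  proof -
    have "ennreal (\<Sum>i<n. content (U i)) \<le> ennreal r"
      using sum_le_suminf[OF summableI, of "{..<n}" "\<lambda>i. ennreal (content (U i))"] real
      by (simp add: sum_ennreal[OF content_nonneg] content_nonneg)
    then show ?thesis using real by (simp add: ennreal_le_iff)
  qed
  have "content (\<Union>i. U i) \<le> r"
  proof (rule content_le)
    fix f assume f: "f \<in> R" "\<And>x. x \<in> topspace T \<Longrightarrow> f x \<le> indicator (\<Union>i. U i) x"
    have cf: "continuous_map T euclideanreal f" using f continuous_R by auto
    show "\<Lambda> f \<le> r"
    proof (rule field_le_epsilon)
      fix e :: real assume "0 < e"
      define d where "d = e / (mass + 1)"
      have d: "0 < d" "d * mass \<le> e"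
        using \<open>0 < e\<close> mass_nonneg by (auto simp: d_def field_simps)
      define K where "K = {x \<in> topspace T. d \<le> f x}"
      have "compactin T K"
        using closedin_compact_space[OF compact_T closedin_level[OF cf]] by (simp add: K_def)
      moreover have "K \<subseteq> \<Union>(range U)"
        unfolding K_def using d(1) f(2) by (rule level_subset)
      ultimately obtain \<F> where \<F>: "finite \<F>" "\<F> \<subseteq> range U" "K \<subseteq> \<Union>\<F>"
        using U unfolding compactin_def by (metis (no_types, lifting) image_iff)
      then obtain I where I: "finite I" "\<F> = U ` I"
        by (meson finite_subset_image)
      then obtain n where "I \<subseteq> {..<n}" using finite_nat_iff_bounded by blast
      then have K: "K \<subseteq> (\<Union>i<n. U i)" using \<F> I by blast
      have fd: "(\<lambda>x. f x + - d) \<in> R" by (intro add_R f const_R)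
      have "\<Lambda> f - d * mass = \<Lambda> (\<lambda>x. f x + - d)"
        using \<Lambda>_add[OF f(1) const_R[of "- d"]] \<Lambda>_const[of "- d"] by simp
      also have "\<dots> \<le> content (\<Union>i<n. U i)"
      proof (rule content_ge[OF fd])
        fix x assume x: "x \<in> topspace T"
        have "f x \<le> 1" using f(2)[OF x] indicator_le_1 by (rule order_trans)
        then show "f x + - d \<le> indicator (\<Union>i<n. U i) x"
          using K x d(1) by (cases "x \<in> K") (auto simp: K_def indicator_def)
      qed
      also have "\<dots> \<le> r" by (rule order_trans[OF content_finite_Union[OF U] sum_le])
      finally show "\<Lambda> f \<le> r + e" using d by linarith
    qed
  qed
  then show ?thesis using real by (simp add: ennreal_leI)
qed simp

definition outer :: "'a set \<Rightarrow> ennreal" where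
  "outer E = (INF U\<in>{U. openin T U \<and> E \<subseteq> U}. ennreal (content U))"

lemma outer_openin:
  assumes "openin T U"
  shows "outer U = ennreal (content U)"
  unfolding outer_def
  by (intro antisym INF_lower INF_greatest) (use assms in \<open>auto intro!: ennreal_leI content_mono\<close>)

lemma outer_mono: "E \<subseteq> F \<Longrightarrow> outer E \<le> outer F"
  unfolding outer_def by (intro INF_superset_mono) auto

lemma outer_less:
  assumes "outer E < c"
  obtains U where "openin T U" "E \<subseteq> U" "ennreal (content U) < c"
  using assms unfolding outer_def INF_less_iff by auto

lemma outer_countable_Union:
  fixes E :: "nat \<Rightarrow> 'a set"
  shows "outer (\<Union>i. E i) \<le> (\<Sum>i. outer (E i))"
proof (rule ennreal_le_epsilon)
  fix e :: real assume e: "0 < e" and fin: "(\<Sum>i. outer (E i)) < top"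
  have "outer (E i) < outer (E i) + e * (1/2) ^ Suc i" for i
    using ennreal_suminf_lessD[OF fin, of i] e by (auto simp: less_top)
  then have "\<exists>U. openin T U \<and> E i \<subseteq> U \<and> ennreal (content U) \<le> outer (E i) + e * (1/2) ^ Suc i" for i
    by (metis outer_less less_imp_le)
  then obtain U where U: "\<And>i. openin T (U i)" "\<And>i. E i \<subseteq> U i"
      "\<And>i. ennreal (content (U i)) \<le> outer (E i) + e * (1/2) ^ Suc i"
    by metis
  have "outer (\<Union>i. E i) \<le> outer (\<Union>i. U i)"
    using U(2) by (intro outer_mono) blast
  also have "\<dots> = ennreal (content (\<Union>i. U i))"
    using U(1) by (intro outer_openin openin_Union) auto
  also have "\<dots> \<le> (\<Sum>i. ennreal (content (U i)))"
    by (rule content_countable_Union[OF U(1)])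
  also have "\<dots> \<le> (\<Sum>i. outer (E i) + e * (1/2) ^ Suc i)"
    by (intro suminf_le U(3)) auto
  also have "\<dots> = (\<Sum>i. outer (E i)) + (\<Sum>i. ennreal e * ennreal ((1/2) ^ Suc i))"
    using e by (subst suminf_add[symmetric])
      (auto simp del: ennreal_suminf_cmult simp add: ennreal_mult[symmetric])
  also have "\<dots> = (\<Sum>i. outer (E i)) + e"
    unfolding ennreal_suminf_cmult
    by (subst suminf_ennreal_eq[OF zero_le_power power_half_series]) auto
  finally show "outer (\<Union>i. E i) \<le> (\<Sum>i. outer (E i)) + e" .
qed

lemma outer_empty: "outer {} = 0"
  using outer_openin[OF openin_empty] content_empty by simp

lemma outer_measure_space_outer: "outer_measure_space (Pow (topspace T)) outer"
  unfolding outer_measure_space_def positive_def increasing_def countably_subadditive_def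
  by (auto intro: outer_empty outer_mono outer_countable_Union)

text \<open>If \<open>f \<le> indicator (V \<inter> U)\<close>, \<open>K = {d \<le> f}\<close> and \<open>g \<le> indicator (V - K)\<close>, then
  \<open>f - d + g \<le> indicator V\<close>.\<close>

lemma content_split:
  assumes U: "openin T U" and V: "openin T V"
  shows "ennreal (content (V \<inter> U)) + outer (V - U) \<le> ennreal (content V)"
proof -
  have "outer (V - U) \<le> outer V" by (rule outer_mono) auto
  also have "\<dots> < top" by (simp add: outer_openin[OF V])
  finally obtain r where r: "0 \<le> r" "outer (V - U) = ennreal r"
    by (cases "outer (V - U)") auto
  have "content (V \<inter> U) \<le> content V - r"
  proof (rule content_le)
    fix f assume f: "f \<in> R" "\<And>x. x \<in> topspace T \<Longrightarrow> f x \<le> indicator (V \<inter> U) x"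
    show "\<Lambda> f \<le> content V - r"
    proof (rule field_le_epsilon)
      fix e :: real assume "0 < e"
      define d where "d = e / (mass + 1)"
      have d: "0 < d" "d * mass \<le> e"
        using \<open>0 < e\<close> mass_nonneg by (auto simp: d_def field_simps)
      define K where "K = {x \<in> topspace T. d \<le> f x}"
      have K: "K \<subseteq> V \<inter> U" unfolding K_def using d(1) f(2) by (rule level_subset)
      have "closedin T K" unfolding K_def by (intro closedin_level continuous_R f)
      then have W: "openin T (V - K)" using V by (rule openin_diff[rotated])
      have "outer (V - U) \<le> outer (V - K)" using K by (intro outer_mono) auto
      then have "r \<le> content (V - K)"
        using r by (simp add: outer_openin[OF W] content_nonneg)
      also have "\<dots> \<le> content V - \<Lambda> f + d * mass"
      proof (rule content_le)
        fix g assume g: "g \<in> R" "\<And>x. x \<in> topspace T \<Longrightarrow> g x \<le> indicator (V - K) x"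
        have "\<Lambda> f + - d * mass + \<Lambda> g = \<Lambda> (\<lambda>x. f x + - d + g x)"
          by (simp only: \<Lambda>_add \<Lambda>_const add_R const_R f g)
        also have "\<dots> \<le> content V"
        proof (rule content_ge)
          show "(\<lambda>x. f x + - d + g x) \<in> R" by (intro add_R const_R f g)
          fix x assume x: "x \<in> topspace T"
          show "f x + - d + g x \<le> indicator V x"
            using f(2)[OF x] g(2)[OF x] d(1) K x
            by (cases "x \<in> K"; cases "x \<in> V"; cases "x \<in> U") (auto simp: K_def)
        qed
        finally show "\<Lambda> g \<le> content V - \<Lambda> f + d * mass" by simp
      qed
      finally show "\<Lambda> f \<le> content V - r + e" using d by linarith
    qed
  qed
  then have "content (V \<inter> U) + r \<le> content V" by simp
  then show ?thesis
    using r content_nonneg by (simp flip: ennreal_plus add: ennreal_leI)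
qed

lemma openin_lambda_system:
  assumes U: "openin T U"
  shows "U \<in> lambda_system (topspace T) (Pow (topspace T)) outer"
proof -
  interpret sigma_algebra "topspace T" "Pow (topspace T)" by (rule sigma_algebra_Pow)
  have "outer (E \<inter> U) + outer (E - U) = outer E" if E: "E \<subseteq> topspace T" for E
  proof (rule antisym)
    show "outer (E \<inter> U) + outer (E - U) \<le> outer E"
      unfolding outer_def[of E]
    proof (rule INF_greatest)
      fix V assume V: "V \<in> {V. openin T V \<and> E \<subseteq> V}"
      have "outer (E \<inter> U) + outer (E - U) \<le> outer (V \<inter> U) + outer (V - U)"
        using V by (intro add_mono outer_mono) auto
      also have "\<dots> \<le> ennreal (content V)"
        using content_split[OF U, of V] V U by (simp add: outer_openin openin_Int)
      finally show "outer (E \<inter> U) + outer (E - U) \<le> ennreal (content V)" .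
    qed
    have "subadditive (Pow (topspace T)) outer"
      using outer_measure_space_outer
      by (auto simp: outer_measure_space_def intro: countably_subadditive_subadditive)
    then have "outer ((E \<inter> U) \<union> (E - U)) \<le> outer (E \<inter> U) + outer (E - U)"
      using E by (intro subadditiveD) auto
    then show "outer E \<le> outer (E \<inter> U) + outer (E - U)" by (simp add: Int_Diff_Un)
  qed
  then show ?thesis
    using openin_subset[OF U] by (auto simp: lambda_system_eq)
qed

definition representing_measure :: "'a measure" where
  "representing_measure = measure_of (topspace T) {U. openin T U} outer"

lemma openin_Pow: "{U. openin T U} \<subseteq> Pow (topspace T)"
  using openin_subset by auto

lemma sets_representing_measure:
  "sets representing_measure = sigma_sets (topspace T) {U. openin T U}"
  unfolding representing_measure_def by (rule sets_measure_of[OF openin_Pow])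

lemma space_representing_measure: "space representing_measure = topspace T"
  unfolding representing_measure_def by (rule space_measure_of[OF openin_Pow])

lemma emeasure_representing_measure:
  assumes "B \<in> sets representing_measure"
  shows "emeasure representing_measure B = outer B"
proof -
  interpret sigma_algebra "topspace T" "Pow (topspace T)" by (rule sigma_algebra_Pow)
  have ms: "measure_space (topspace T) (lambda_system (topspace T) (Pow (topspace T)) outer) outer"
    by (rule caratheodory_lemma[OF outer_measure_space_outer])
  then have "sigma_sets (topspace T) {U. openin T U}
      \<subseteq> lambda_system (topspace T) (Pow (topspace T)) outer"
    using openin_lambda_system
    by (intro sigma_algebra.sigma_sets_subset) (auto simp: measure_space_def)
  then have "measure_space (topspace T) (sigma_sets (topspace T) {U. openin T U}) outer"
    by (intro measure_down[OF ms] sigma_algebra_sigma_sets[OF openin_Pow])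
  then show ?thesis
    using assms sets_representing_measure
    by (intro emeasure_measure_of[OF representing_measure_def openin_Pow])
      (auto simp: measure_space_def)
qed

lemma sets_openin: "openin T U \<Longrightarrow> U \<in> sets representing_measure"
  by (auto simp: sets_representing_measure)

lemma emeasure_openin:
  "openin T U \<Longrightarrow> emeasure representing_measure U = ennreal (content U)"
  by (simp add: emeasure_representing_measure sets_openin outer_openin)

lemma emeasure_space_representing_measure:
  "emeasure representing_measure (space representing_measure) = ennreal mass"
  by (simp add: space_representing_measure emeasure_openin content_topspace)

sublocale M: finite_measure representing_measure
  by standard (simp add: emeasure_space_representing_measure)

lemma borel_measurable_continuous_map:
  assumes "sets M = sigma_sets (topspace T) {U. openin T U}" "continuous_map T euclideanreal f"
  shows "f \<in> borel_measurable M"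
proof (rule borel_measurableI)
  fix S :: "real set" assume "open S"
  have "space M = topspace T"
    using sets_eq_imp_space_eq[of M representing_measure] assms(1)
    by (simp add: sets_representing_measure space_representing_measure)
  then have "f -` S \<inter> space M = {x \<in> topspace T. f x \<in> S}" by auto
  then show "f -` S \<inter> space M \<in> sets M"
    using openin_continuous_map_preimage[OF assms(2), of S] \<open>open S\<close> by (simp add: assms(1))
qed

lemma radon_representing_measure: "radon_measure T representing_measure"
  unfolding radon_measure_def
proof (intro conjI ballI)
  show "sets representing_measure = sets (sigma (topspace T) {U. openin T U})"
    by (simp add: sets_representing_measure sets_measure_of[OF openin_Pow])
next
  fix x assume "x \<in> topspace T"
  then show "\<exists>U. openin T U \<and> x \<in> U \<and> emeasure representing_measure U < \<infinity>"
    by (intro exI[of _ "topspace T"]) (auto simp: emeasure_openin)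
next
  fix B assume B: "B \<in> sets representing_measure"
  define \<K> where "\<K> = {K. compactin T K \<and> K \<subseteq> B}"
  have KM: "K \<in> sets representing_measure" if "K \<in> \<K>" for K
  proof -
    have "closedin T K"
      using that Hausdorff_T by (auto simp: \<K>_def intro: compactin_imp_closedin)
    then have "openin T (topspace T - K)" "K = topspace T - (topspace T - K)"
      by (auto simp: closedin_def)
    then show ?thesis
      using sets_openin sets.compl_sets space_representing_measure by metis
  qed
  show "emeasure representing_measure B = (SUP K\<in>{K. compactin T K \<and> K \<subseteq> B}. emeasure representing_measure K)"
    unfolding \<K>_def[symmetric]
  proof (rule antisym)
    show "(SUP K\<in>\<K>. emeasure representing_measure K) \<le> emeasure representing_measure B"
      by (intro SUP_least emeasure_mono B) (auto simp: \<K>_def)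
    show "emeasure representing_measure B \<le> (SUP K\<in>\<K>. emeasure representing_measure K)"
    proof (rule ennreal_le_epsilon)
      fix e :: real assume e: "0 < e"
      let ?C = "topspace T - B"
      have C: "?C \<in> sets representing_measure"
        using B sets.compl_sets space_representing_measure by metis
      have "outer ?C < outer ?C + ennreal e"
        using e M.emeasure_finite[of ?C] C
        by (simp add: emeasure_representing_measure less_top)
      then obtain U where U: "openin T U" "?C \<subseteq> U" "ennreal (content U) < outer ?C + ennreal e"
        by (rule outer_less)
      define K where "K = topspace T - U"
      have "closedin T K" unfolding K_def using U(1) by (intro closedin_diff closedin_topspace)
      moreover have "K \<subseteq> B" using U(2) by (auto simp: K_def)
      ultimately have K: "K \<in> \<K>"
        using closedin_compact_space[OF compact_T] by (simp add: \<K>_def)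
      have BT: "B \<subseteq> topspace T"
        using sets.sets_into_space[OF B] by (simp add: space_representing_measure)
      have "B = K \<union> (B \<inter> U)" using BT \<open>K \<subseteq> B\<close> by (auto simp: K_def)
      then have "emeasure representing_measure B
          \<le> emeasure representing_measure K + emeasure representing_measure (B \<inter> U)"
        using emeasure_subadditive[of K representing_measure "B \<inter> U"] KM[OF K] B sets_openin[OF U(1)]
        by (metis sets.Int)
      moreover have "emeasure representing_measure (B \<inter> U) \<le> ennreal e"
      proof -
        have "emeasure representing_measure (B \<inter> U) + emeasure representing_measure ?C
            = emeasure representing_measure U"
          using B C sets_openin[OF U(1)] U(2) openin_subset[OF U(1)]
          by (subst plus_emeasure) (auto intro!: arg_cong[where f="emeasure representing_measure"])
        also have "\<dots> \<le> ennreal e + emeasure representing_measure ?C"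
          using U(3) C by (simp add: emeasure_openin[OF U(1)] emeasure_representing_measure add.commute)
        finally show ?thesis
          using M.emeasure_finite[of ?C] by (simp add: ennreal_add_left_cancel_le add.commute)
      qed
      moreover have "emeasure representing_measure K \<le> (SUP K\<in>\<K>. emeasure representing_measure K)"
        using K by (rule SUP_upper)
      ultimately show "emeasure representing_measure B
          \<le> (SUP K\<in>\<K>. emeasure representing_measure K) + ennreal e"
        by (meson add_mono order_trans)
    qed
  qed
qed

lemma integrable_representing_measure:
  assumes "continuous_map T euclideanreal f"
  shows "integrable representing_measure f"
proof -
  obtain b where "\<And>x. x \<in> topspace T \<Longrightarrow> \<bar>f x\<bar> \<le> b"
    using continuous_map_bounded[OF assms] by metis
  then show ?thesis
    using borel_measurable_continuous_map[OF sets_representing_measure assms]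
    by (intro M.integrable_const_bound[of _ b])
      (auto intro!: AE_I2 simp: space_representing_measure)
qed

lemma measure_space_representing_measure:
  "measure representing_measure (topspace T) = mass"
  using emeasure_space_representing_measure mass_nonneg
  by (simp add: measure_def space_representing_measure)

lemma lower_layer:
  assumes f: "f \<in> R" and d: "0 < d"
  shows "lower (\<lambda>x. layer d (f x) k) \<le> d * content {x \<in> topspace T. real k * d < f x}"
proof (rule lower_le)
  show "0 \<le> layer d (f x) k" for x using d by (simp add: layer_def)
next
  fix g assume g: "g \<in> R" "\<And>x. x \<in> topspace T \<Longrightarrow> g x \<le> layer d (f x) k"
  have "(1 / d) * \<Lambda> g = \<Lambda> (\<lambda>x. (1 / d) * g x)" by (rule \<Lambda>_scale[OF g(1), symmetric])
  also have "\<dots> \<le> content {x \<in> topspace T. real k * d < f x}"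
  proof (rule content_ge[OF scale_R[OF g(1)]])
    fix x assume x: "x \<in> topspace T"
    show "(1 / d) * g x \<le> indicator {x \<in> topspace T. real k * d < f x} x"
      using g(2)[OF x] d x
      by (cases "real k * d < f x") (auto simp: layer_def field_simps)
  qed
  finally show "\<Lambda> g \<le> d * content {x \<in> topspace T. real k * d < f x}"
    using d by (simp add: field_simps)
qed

text \<open>Layer cake with step \<open>d = 1 / n\<close>: \<open>f\<close> is the sum of its layers, each of which is bounded by
  \<open>d\<close> times the indicator of a level set, and the sum of these bounds is at most \<open>f + d\<close>.\<close>

lemma \<Lambda>_le_integral_unit:
  assumes f: "f \<in> R" and range: "\<And>x. x \<in> topspace T \<Longrightarrow> 0 \<le> f x \<and> f x \<le> 1"
  shows "\<Lambda> f \<le> integral\<^sup>L representing_measure f"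
proof (rule field_le_epsilon)
  fix e :: real assume "0 < e"
  obtain n where n: "0 < n" "mass / e < real n"
    using reals_Archimedean2[of "max 1 (mass / e)"] by (metis gr0I max_less_iff_conj not_one_less_zero of_nat_0)
  define d where "d = 1 / real n"
  have d: "0 < d" "real n * d = 1" "d * mass \<le> e"
    using n \<open>0 < e\<close> by (auto simp: d_def field_simps)
  have cf: "continuous_map T euclideanreal f" by (rule continuous_R[OF f])
  define U where "U k = {x \<in> topspace T. real k * d < f x}" for k
  have U: "U k \<in> sets representing_measure" for k
    unfolding U_def by (intro sets_openin openin_level cf)
  have intU: "integrable representing_measure (indicator (U k) :: 'a \<Rightarrow> real)" for k
    using U by (intro integrable_real_indicator) (auto simp flip: less_top)
  have clayer: "continuous_map T euclideanreal (\<lambda>x. layer d (f x) k)" for k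
    unfolding layer_def
    by (intro continuous_map_real_min continuous_map_real_max continuous_map_diff cf) auto
  have "\<Lambda> f \<le> lower (\<lambda>x. \<Sum>k<n. layer d (f x) k)"
    by (rule lower_ge[OF f, where b=1]) (use range d in \<open>auto simp: sum_layer\<close>)
  also have "\<dots> \<le> (\<Sum>k<n. lower (\<lambda>x. layer d (f x) k))"
    by (rule lower_sum[OF _ clayer]) auto
  also have "\<dots> \<le> (\<Sum>k<n. d * content (U k))"
    unfolding U_def by (intro sum_mono lower_layer f d)
  also have "\<dots> = (\<Sum>k<n. d * measure representing_measure (U k))"
    by (simp add: measure_def U_def emeasure_openin openin_level[OF cf] content_nonneg)
  also have "\<dots> = (\<integral>x. (\<Sum>k<n. d * indicator (U k) x) \<partial>representing_measure)"
    using U intU by (subst Bochner_Integration.integral_sum) (simp_all del: sum_mult_indicator)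
  also have "\<dots> \<le> (\<integral>x. f x + d \<partial>representing_measure)"
  proof (rule integral_mono)
    show "integrable representing_measure (\<lambda>x. \<Sum>k<n. d * indicator (U k) x)"
      by (intro Bochner_Integration.integrable_sum integrable_mult_right intU)
    show "integrable representing_measure (\<lambda>x. f x + d)"
      by (intro Bochner_Integration.integrable_add integrable_representing_measure cf) auto
    fix x assume "x \<in> space representing_measure"
    then have x: "x \<in> topspace T" by (simp add: space_representing_measure)
    then have "(\<Sum>k<n. d * indicator (U k) x) = (\<Sum>k<n. d * of_bool (real k * d < f x))"
      by (simp add: U_def indicator_def)
    also have "\<dots> \<le> f x + d"
      using sum_indicator_levels[of "f x" d n] range[OF x] d by simp
    finally show "(\<Sum>k<n. d * indicator (U k) x) \<le> f x + d" .
  qed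
  also have "\<dots> = integral\<^sup>L representing_measure f + d * mass"
    using integrable_representing_measure[OF cf]
    by (simp add: space_representing_measure measure_space_representing_measure)
  finally show "\<Lambda> f \<le> integral\<^sup>L representing_measure f + e" using d by linarith
qed

lemma \<Lambda>_le_integral:
  assumes f: "f \<in> R"
  shows "\<Lambda> f \<le> integral\<^sup>L representing_measure f"
proof -
  obtain b where b: "0 < b" "\<And>x. x \<in> topspace T \<Longrightarrow> \<bar>f x\<bar> \<le> b"
    using continuous_map_bounded[OF continuous_R[OF f]] by metis
  define c where "c = 1 / (2 * b)"
  have c: "0 < c" "c * b = 1 / 2" using b(1) by (auto simp: c_def)
  have "\<Lambda> (\<lambda>x. c * f x + 1 / 2) \<le> (\<integral>x. c * f x + 1 / 2 \<partial>representing_measure)"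
  proof (rule \<Lambda>_le_integral_unit)
    show "(\<lambda>x. c * f x + 1 / 2) \<in> R" by (intro add_R scale_R const_R f)
    fix x assume "x \<in> topspace T"
    then have "\<bar>c * f x\<bar> \<le> c * b" using b(2) c(1) by (simp add: abs_mult)
    then show "0 \<le> c * f x + 1 / 2 \<and> c * f x + 1 / 2 \<le> 1" using c(2) by linarith
  qed
  then have "c * \<Lambda> f + 1 / 2 * mass \<le> c * integral\<^sup>L representing_measure f + 1 / 2 * mass"
    using integrable_representing_measure[OF continuous_R[OF f]]
    by (simp add: \<Lambda>_add \<Lambda>_scale \<Lambda>_const scale_R const_R f
        space_representing_measure measure_space_representing_measure)
  then show ?thesis using c(1) by simp
qed

lemma integral_representing_measure:
  assumes f: "f \<in> R"
  shows "integral\<^sup>L representing_measure f = \<Lambda> f"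
  using \<Lambda>_le_integral[OF f] \<Lambda>_le_integral[OF scale_R[OF f, of "- 1"]] \<Lambda>_scale[OF f, of "- 1"]
  by simp

lemma emeasure_openin_unique:
  assumes M: "radon_measure T M"
    and int: "\<And>f. f \<in> R \<Longrightarrow> integrable M f" "\<And>f. f \<in> R \<Longrightarrow> integral\<^sup>L M f = \<Lambda> f"
    and U: "openin T U"
  shows "emeasure M U = ennreal (content U)"
proof -
  have sets_M: "sets M = sigma_sets (topspace T) {U. openin T U}"
    using M by (simp add: radon_measure_def sets_measure_of[OF openin_Pow])
  have space_M: "space M = topspace T"
    using sets_eq_imp_space_eq[of M representing_measure] sets_M
    by (simp add: sets_representing_measure space_representing_measure)
  have "integrable M (\<lambda>_. 1 :: real)" by (rule int(1)[OF const_R])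
  then interpret finite_measure M
    by (intro finite_measureI) (simp add: integrable_iff_bounded)
  have mass: "measure M (space M) = mass"
    using int(2)[OF const_R[of 1]] by (simp add: mass_def)
  have UM: "U \<in> sets M" using U by (simp add: sets_M)
  have "content U \<le> measure M U"
  proof (rule content_le)
    fix f assume f: "f \<in> R" "\<And>x. x \<in> topspace T \<Longrightarrow> f x \<le> indicator U x"
    have "\<Lambda> f = integral\<^sup>L M f" by (simp add: int(2)[OF f(1)])
    also have "\<dots> \<le> integral\<^sup>L M (indicator U)"
      by (rule integral_mono[OF int(1)[OF f(1)]])
        (use f UM in \<open>auto simp: space_M simp flip: less_top intro: integrable_real_indicator\<close>)
    finally show "\<Lambda> f \<le> measure M U" using UM by simp
  qed
  moreover have "emeasure M U \<le> ennreal (content U)"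
  proof -
    have "emeasure M K \<le> ennreal (content U)" if K: "compactin T K" "K \<subseteq> U" for K
    proof -
      have Kc: "closedin T K" using K Hausdorff_T by (auto intro: compactin_imp_closedin)
      have KM: "K \<in> sets M"
      proof -
        have "topspace T - (topspace T - K) \<in> sets M"
          using Kc space_M sets.compl_sets[of "topspace T - K" M] by (auto simp: sets_M closedin_def)
        then show ?thesis using closedin_subset[OF Kc] by (simp add: double_diff)
      qed
      have "closedin T (topspace T - U)" using U by (intro closedin_diff closedin_topspace)
      then obtain \<phi> where \<phi>: "continuous_map T euclideanreal \<phi>"
        "\<And>x. x \<in> topspace T \<Longrightarrow> \<phi> x \<in> {0..1}"
        "\<And>x. x \<in> topspace T - U \<Longrightarrow> \<phi> x = (0::real)" "\<And>x. x \<in> K \<Longrightarrow> \<phi> x = 1"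
        using Urysohn_T[of "topspace T - U" K] Kc K by blast
      have "measure M K \<le> content U"
      proof (rule field_le_epsilon)
        fix e :: real assume "0 < e"
        define d where "d = e / (mass + 1)"
        have d: "0 < d" "d * mass \<le> e"
          using \<open>0 < e\<close> mass_nonneg by (auto simp: d_def field_simps)
        obtain g where g: "g \<in> R" "\<And>x. x \<in> topspace T \<Longrightarrow> g x \<le> \<phi> x"
            "\<And>x. x \<in> topspace T \<Longrightarrow> \<phi> x \<le> g x + d"
          using approx_below[OF \<phi>(1) d(1)] by metis
        have "measure M K = integral\<^sup>L M (indicator K)" using KM by simp
        also have "\<dots> \<le> (\<integral>x. g x + d \<partial>M)"
        proof (intro integral_mono)
          show "integrable M (\<lambda>x. g x + d)" using int(1)[OF g(1)] by simp
          fix x assume "x \<in> space M"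
          then have x: "x \<in> topspace T" by (simp add: space_M)
          show "indicator K x \<le> g x + d"
            using g(3)[OF x] \<phi>(2)[OF x] \<phi>(4)[of x] by (cases "x \<in> K") auto
        qed (use KM in \<open>auto simp flip: less_top intro: integrable_real_indicator\<close>)
        also have "\<dots> = \<Lambda> g + d * mass"
          using int[OF g(1)] mass by simp
        also have "\<Lambda> g \<le> content U"
        proof (rule content_ge[OF g(1)])
          fix x assume x: "x \<in> topspace T"
          show "g x \<le> indicator U x"
            using g(2)[OF x] \<phi>(2)[OF x] \<phi>(3)[of x] x by (cases "x \<in> U") auto
        qed
        finally show "measure M K \<le> content U + e" using d by linarith
      qed
      then show ?thesis by (simp add: emeasure_eq_measure ennreal_leI)
    qed
    then show ?thesis
      using M UM unfolding radon_measure_def by (auto intro!: SUP_least)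
  qed
  ultimately show ?thesis
    by (simp add: emeasure_eq_measure content_nonneg)
qed

theorem ex1_representing_measure:
  "\<exists>!M. radon_measure T M \<and> (\<forall>f\<in>R. integrable M f \<and> integral\<^sup>L M f = \<Lambda> f)"
proof (rule ex1I[of _ representing_measure])
  show "radon_measure T representing_measure \<and>
      (\<forall>f\<in>R. integrable representing_measure f \<and> integral\<^sup>L representing_measure f = \<Lambda> f)"
    using radon_representing_measure integrable_representing_measure continuous_R
      integral_representing_measure by blast
next
  fix N assume N: "radon_measure T N \<and> (\<forall>f\<in>R. integrable N f \<and> integral\<^sup>L N f = \<Lambda> f)"
  then have N_openin: "emeasure N U = ennreal (content U)" if "openin T U" for U
    using emeasure_openin_unique[of N U] that by blast
  show "N = representing_measure"
  proof (rule measure_eqI_generator_eq[where A="\<lambda>_. topspace T"])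
    show "Int_stable {U. openin T U}" by (auto simp: Int_stable_def openin_Int)
    show "sets N = sigma_sets (topspace T) {U. openin T U}"
      using N by (simp add: radon_measure_def sets_measure_of[OF openin_Pow])
  qed (auto simp: openin_Pow N_openin emeasure_openin sets_representing_measure openin_subset)
qed

end

section \<open>The Gelfand spectrum\<close>

definition eval_at :: "('x \<Rightarrow> real) set \<Rightarrow> 'x \<Rightarrow> ('x \<Rightarrow> real) \<Rightarrow> real" where
  "eval_at A x = (\<lambda>a\<in>A. a x)"

locale bounded_function_algebra =
  fixes X :: "'x set" and A :: "('x \<Rightarrow> real) set"
  assumes nonempty: "X \<noteq> {}" and algebra: "unital_subalgebra X A"
begin

lemma A_linf: "a \<in> A \<Longrightarrow> a \<in> linf X"
  using algebra by (auto simp: unital_subalgebra_def)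

lemma A_const: "(\<lambda>x\<in>X. c) \<in> A"
proof -
  have "(\<lambda>x\<in>X. c * (\<lambda>x\<in>X. 1) x) \<in> A" using algebra unfolding unital_subalgebra_def by blast
  also have "(\<lambda>x\<in>X. c * (\<lambda>x\<in>X. 1) x) = (\<lambda>x\<in>X. c)" by (auto simp: restrict_def)
  finally show ?thesis .
qed

lemma A_add: "a \<in> A \<Longrightarrow> b \<in> A \<Longrightarrow> (\<lambda>x\<in>X. a x + b x) \<in> A"
  and A_scale: "a \<in> A \<Longrightarrow> (\<lambda>x\<in>X. c * a x) \<in> A"
  and A_mult: "a \<in> A \<Longrightarrow> b \<in> A \<Longrightarrow> (\<lambda>x\<in>X. a x * b x) \<in> A"
  using algebra by (auto simp: unital_subalgebra_def)

lemma A_restrict: "a \<in> A \<Longrightarrow> (\<lambda>x\<in>X. a x) = a"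
  using A_linf[of a] by (auto simp: linf_def intro!: PiE_restrict)

lemma A_diff:
  assumes "a \<in> A" "b \<in> A"
  shows "(\<lambda>x\<in>X. a x - b x) \<in> A"
proof -
  have "(\<lambda>x\<in>X. a x + (\<lambda>x\<in>X. (- 1) * b x) x) \<in> A"
    using assms by (intro A_add A_scale)
  also have "(\<lambda>x\<in>X. a x + (\<lambda>x\<in>X. (- 1) * b x) x) = (\<lambda>x\<in>X. a x - b x)"
    by (auto simp: restrict_def)
  finally show ?thesis .
qed

lemma A_power: "a \<in> A \<Longrightarrow> (\<lambda>x\<in>X. a x ^ k) \<in> A"
proof (induction k)
  case 0
  then show ?case using A_const[of 1] by (simp only: power_0)
next
  case (Suc k)
  then have "(\<lambda>x\<in>X. a x * (\<lambda>x\<in>X. a x ^ k) x) \<in> A" by (intro A_mult)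
  also have "(\<lambda>x\<in>X. a x * (\<lambda>x\<in>X. a x ^ k) x) = (\<lambda>x\<in>X. a x ^ Suc k)" by (auto simp: restrict_def)
  finally show ?case .
qed

lemma abs_le_sup_norm:
  assumes "a \<in> A" "x \<in> X"
  shows "\<bar>a x\<bar> \<le> sup_norm X a"
proof -
  have "bdd_above ((\<lambda>x. \<bar>a x\<bar>) ` X)"
    using A_linf[OF assms(1)] by (auto simp: linf_def bounded_iff bdd_above_def)
  then show ?thesis
    using A_linf[OF assms(1)] assms(2) by (auto simp: sup_norm_def intro: cSUP_upper)
qed

lemma sup_norm_nonneg: "a \<in> A \<Longrightarrow> 0 \<le> sup_norm X a"
  using abs_le_sup_norm nonempty by (meson abs_ge_zero all_not_in_conv order_trans)

lemma sup_norm_le: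
  assumes "a \<in> A" "\<And>x. x \<in> X \<Longrightarrow> \<bar>a x\<bar> \<le> c"
  shows "sup_norm X a \<le> c"
  using A_linf[OF assms(1)] assms(2) nonempty by (auto simp: sup_norm_def intro: cSUP_least)

lemma Metric_space_A: "Metric_space A (sup_dist X)"
  using nonempty A_linf by (intro Metric_space_sup_dist) auto

lemma topspace_sup_topology: "topspace (sup_topology X A) = A"
  unfolding sup_topology_def by (rule Metric_space.topspace_mtopology[OF Metric_space_A])

lemma linear_functional_diff:
  assumes "linear_functional X A \<alpha>" "a \<in> A" "b \<in> A"
  shows "\<alpha> (\<lambda>x\<in>X. a x - b x) = \<alpha> a - \<alpha> b"
proof -
  have "\<alpha> (\<lambda>x\<in>X. a x + (\<lambda>x\<in>X. (- 1) * b x) x) = \<alpha> a + (- 1) * \<alpha> b"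
    using assms A_scale unfolding linear_functional_def by metis
  moreover have "(\<lambda>x\<in>X. a x + (\<lambda>x\<in>X. (- 1) * b x) x) = (\<lambda>x\<in>X. a x - b x)"
    by (auto simp: restrict_def)
  ultimately show ?thesis by simp
qed

lemma unital_algebra_hom_power:
  assumes hom: "unital_algebra_hom X A \<alpha>" and a: "a \<in> A"
  shows "\<alpha> (\<lambda>x\<in>X. a x ^ k) = \<alpha> a ^ k"
proof (induction k)
  case 0
  then show ?case using hom by (simp only: unital_algebra_hom_def power_0)
next
  case (Suc k)
  have "\<alpha> (\<lambda>x\<in>X. a x * (\<lambda>x\<in>X. a x ^ k) x) = \<alpha> a * \<alpha> (\<lambda>x\<in>X. a x ^ k)"
    using hom a A_power[OF a] unfolding unital_algebra_hom_def by blast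
  moreover have "(\<lambda>x\<in>X. a x * (\<lambda>x\<in>X. a x ^ k) x) = (\<lambda>x\<in>X. a x ^ Suc k)"
    by (auto simp: restrict_def)
  ultimately show ?case by (simp only: Suc power_Suc)
qed

lemma continuous_at_zero:
  assumes lin: "linear_functional X A \<alpha>"
    and cont: "continuous_map (sup_topology X A) euclideanreal \<alpha>"
  obtains \<delta> where "0 < \<delta>" "\<And>a. a \<in> A \<Longrightarrow> sup_norm X a < \<delta> \<Longrightarrow> \<bar>\<alpha> a\<bar> < 1"
proof -
  interpret Metric_space A "sup_dist X" by (rule Metric_space_A)
  let ?z = "\<lambda>x\<in>X. 0 :: real"
  have "(\<lambda>x\<in>X. ?z x - ?z x) = ?z" by (rule ext) simp
  then have "\<alpha> ?z = 0"
    using linear_functional_diff[OF lin A_const[of 0] A_const[of 0]] by simp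
  then have "?z \<in> {a \<in> A. \<alpha> a \<in> ball 0 1}" using A_const[of 0] by simp
  moreover have "openin mtopology {a \<in> A. \<alpha> a \<in> ball 0 1}"
    using openin_continuous_map_preimage[OF cont, of "ball 0 1"]
    unfolding topspace_sup_topology unfolding sup_topology_def by simp
  ultimately obtain \<delta> where \<delta>: "0 < \<delta>" "mball ?z \<delta> \<subseteq> {a \<in> A. \<alpha> a \<in> ball 0 1}"
    unfolding openin_mtopology by blast
  show ?thesis
  proof
    fix a assume a: "a \<in> A" "sup_norm X a < \<delta>"
    have "(\<lambda>x\<in>X. a x - ?z x) = (\<lambda>x\<in>X. a x)" by (rule ext) simp
    then have "sup_dist X a ?z = sup_norm X a"
      unfolding sup_dist_def by (simp only: A_restrict[OF a(1)])
    then have "sup_dist X ?z a = sup_norm X a" by (simp only: commute)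
    then have "a \<in> mball ?z \<delta>" using a A_const by (simp add: in_mball)
    then show "\<bar>\<alpha> a\<bar> < 1" using \<delta>(2) by auto
  qed (use \<delta> in simp)
qed

text \<open>If \<open>\<bar>\<alpha> a\<bar>\<close> exceeded the norm of \<open>a\<close>, the powers of \<open>a / \<alpha> a\<close> would tend to \<open>0\<close> in norm,
  although \<open>\<alpha>\<close> maps each of them to \<open>1\<close>.\<close>

lemma character_le_sup_norm:
  assumes hom: "unital_algebra_hom X A \<alpha>"
    and cont: "continuous_map (sup_topology X A) euclideanreal \<alpha>"
    and a: "a \<in> A"
  shows "\<bar>\<alpha> a\<bar> \<le> sup_norm X a"
proof (rule ccontr)
  assume "\<not> \<bar>\<alpha> a\<bar> \<le> sup_norm X a"
  then have r: "sup_norm X a < \<bar>\<alpha> a\<bar>" by simp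
  have lin: "linear_functional X A \<alpha>" using hom by (simp add: unital_algebra_hom_def)
  obtain \<delta> where \<delta>: "0 < \<delta>" "\<And>b. b \<in> A \<Longrightarrow> sup_norm X b < \<delta> \<Longrightarrow> \<bar>\<alpha> b\<bar> < 1"
    using continuous_at_zero[OF lin cont] by metis
  define q where "q = sup_norm X a / \<bar>\<alpha> a\<bar>"
  have q: "0 \<le> q" "q < 1" using r sup_norm_nonneg[OF a] by (auto simp: q_def)
  then obtain k where k: "q ^ k < \<delta>"
    using real_arch_pow_inv[OF \<delta>(1)] by blast
  define b where "b = (\<lambda>x\<in>X. inverse (\<alpha> a ^ k) * (\<lambda>x\<in>X. a x ^ k) x)"
  have b: "b \<in> A" unfolding b_def by (intro A_scale A_power a)
  have "\<bar>b x\<bar> \<le> q ^ k" if "x \<in> X" for x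
  proof -
    have "\<bar>b x\<bar> = (\<bar>a x\<bar> / \<bar>\<alpha> a\<bar>) ^ k"
      using that by (simp add: b_def abs_mult power_abs power_divide field_simps)
    also have "\<dots> \<le> q ^ k"
      unfolding q_def using abs_le_sup_norm[OF a that] by (intro power_mono divide_right_mono) auto
    finally show ?thesis .
  qed
  then have "sup_norm X b < \<delta>" using sup_norm_le[OF b] k by force
  then have "\<bar>\<alpha> b\<bar> < 1" by (rule \<delta>(2)[OF b])
  moreover have "\<alpha> b = inverse (\<alpha> a ^ k) * \<alpha> (\<lambda>x\<in>X. a x ^ k)"
    using lin A_power[OF a] unfolding b_def linear_functional_def by blast
  moreover have "\<alpha> a \<noteq> 0" using r sup_norm_nonneg[OF a] by auto
  ultimately show False by (simp add: unital_algebra_hom_power[OF hom a])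
qed

lemma bounded_functional_continuous:
  assumes lin: "linear_functional X A \<alpha>"
    and bound: "\<And>a. a \<in> A \<Longrightarrow> \<bar>\<alpha> a\<bar> \<le> sup_norm X a"
  shows "continuous_map (sup_topology X A) euclideanreal \<alpha>"
proof -
  interpret Metric_space A "sup_dist X" by (rule Metric_space_A)
  have "openin mtopology {a \<in> A. \<alpha> a \<in> U}" if U: "open U" for U
    unfolding openin_mtopology
  proof safe
    fix a assume a: "a \<in> A" "\<alpha> a \<in> U"
    obtain r where r: "0 < r" "ball (\<alpha> a) r \<subseteq> U" using U a(2) openE by blast
    have "mball a r \<subseteq> {a \<in> A. \<alpha> a \<in> U}"
    proof
      fix b assume "b \<in> mball a r"
      then have b: "b \<in> A" "sup_dist X a b < r" by auto
      have "\<bar>\<alpha> a - \<alpha> b\<bar> \<le> sup_dist X a b"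
        using bound[OF A_diff[OF a(1) b(1)]] linear_functional_diff[OF lin a(1) b(1)]
        by (simp add: sup_dist_def)
      then have "\<alpha> b \<in> ball (\<alpha> a) r" using b(2) by (simp add: dist_real_def)
      then show "b \<in> {a \<in> A. \<alpha> a \<in> U}" using r(2) b(1) by auto
    qed
    then show "\<exists>r>0. mball a r \<subseteq> {a \<in> A. \<alpha> a \<in> U}" using r(1) by blast
  qed
  then show ?thesis
    by (auto simp: continuous_map_def topspace_sup_topology sup_topology_def)
qed

lemma gelfand_spectrum_iff:
  "\<alpha> \<in> gelfand_spectrum X A \<longleftrightarrow>
    (\<forall>a. a \<notin> A \<longrightarrow> \<alpha> a = undefined) \<and> unital_algebra_hom X A \<alpha> \<and> (\<forall>a\<in>A. \<bar>\<alpha> a\<bar> \<le> sup_norm X a)"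
proof -
  have "continuous_map (sup_topology X A) euclideanreal \<alpha> \<longleftrightarrow> (\<forall>a\<in>A. \<bar>\<alpha> a\<bar> \<le> sup_norm X a)"
    if hom: "unital_algebra_hom X A \<alpha>"
  proof
    assume "continuous_map (sup_topology X A) euclideanreal \<alpha>"
    then show "\<forall>a\<in>A. \<bar>\<alpha> a\<bar> \<le> sup_norm X a"
      by (intro ballI character_le_sup_norm[OF hom])
  next
    assume "\<forall>a\<in>A. \<bar>\<alpha> a\<bar> \<le> sup_norm X a"
    moreover have "linear_functional X A \<alpha>" using hom by (simp only: unital_algebra_hom_def)
    ultimately show "continuous_map (sup_topology X A) euclideanreal \<alpha>"
      by (intro bounded_functional_continuous) auto
  qed
  then show ?thesis
    unfolding gelfand_spectrum_def PiE_def extensional_def by auto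
qed

lemma compact_gelfand_spectrum: "compact (gelfand_spectrum X A)"
proof -
  let ?B = "\<lambda>a. if a \<in> A then {- sup_norm X a..sup_norm X a} else {undefined}"
  have "compactin (product_topology (\<lambda>_. euclideanreal) UNIV) (PiE UNIV ?B)"
    by (simp add: compactin_PiE)
  then have "compact (PiE UNIV ?B)" by (simp add: euclidean_product_topology)
  moreover have "closed (gelfand_spectrum X A)"
  proof -
    have coord: "continuous_on UNIV (\<lambda>\<alpha> :: ('x \<Rightarrow> real) \<Rightarrow> real. \<alpha> a)" for a
      by simp
    have "gelfand_spectrum X A = {\<alpha>. (\<forall>a. a \<notin> A \<longrightarrow> \<alpha> a = undefined) \<and>
        (\<forall>a. a \<in> A \<longrightarrow> (\<forall>b. b \<in> A \<longrightarrow> \<alpha> (\<lambda>x\<in>X. a x + b x) = \<alpha> a + \<alpha> b)) \<and>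
        (\<forall>c a. a \<in> A \<longrightarrow> \<alpha> (\<lambda>x\<in>X. c * a x) = c * \<alpha> a) \<and>
        (\<forall>a. a \<in> A \<longrightarrow> (\<forall>b. b \<in> A \<longrightarrow> \<alpha> (\<lambda>x\<in>X. a x * b x) = \<alpha> a * \<alpha> b)) \<and>
        \<alpha> (\<lambda>x\<in>X. 1) = 1 \<and>
        (\<forall>a. a \<in> A \<longrightarrow> \<bar>\<alpha> a\<bar> \<le> sup_norm X a)}"
      by (auto simp: gelfand_spectrum_iff unital_algebra_hom_def linear_functional_def)
    also have "closed \<dots>"
      by (intro closed_Collect_conj closed_Collect_all closed_Collect_imp closed_Collect_eq
          closed_Collect_le open_Collect_const continuous_intros coord)
    finally show ?thesis .
  qed
  moreover have "gelfand_spectrum X A \<subseteq> PiE UNIV ?B"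
    by (auto simp: gelfand_spectrum_iff abs_le_iff minus_le_iff)
  ultimately show ?thesis
    using compact_Int_closed[of "PiE UNIV ?B" "gelfand_spectrum X A"] by (simp add: Int_absorb1)
qed

lemma gelfand_topology_eq: "gelfand_topology X A = top_of_set (gelfand_spectrum X A)"
proof -
  let ?S = "gelfand_spectrum X A"
  have ext: "?S \<subseteq> A \<rightarrow>\<^sub>E UNIV" by (auto simp: gelfand_spectrum_def)
  have top: "topspace (gelfand_topology X A) = ?S"
    using ext by (auto simp: gelfand_topology_def)
  have "continuous_map (top_of_set ?S) (gelfand_topology X A) id"
    unfolding gelfand_topology_def continuous_map_in_subtopology continuous_map_componentwise
    using ext by (auto intro!: continuous_on_subset[OF continuous_on_product_coordinates] simp: PiE_def)
  moreover have "continuous_map (gelfand_topology X A) (top_of_set ?S) id"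
  proof -
    have "continuous_map (gelfand_topology X A) euclideanreal (\<lambda>\<alpha>. \<alpha> a)" for a
    proof (cases "a \<in> A")
      case True
      then show ?thesis
        unfolding gelfand_topology_def
        by (intro continuous_map_from_subtopology continuous_map_product_projection)
    next
      case False
      have "continuous_map (gelfand_topology X A) euclideanreal (\<lambda>_. undefined)" by simp
      then show ?thesis
        by (rule continuous_map_eq) (use False top in \<open>auto simp: gelfand_spectrum_iff\<close>)
    qed
    then have "continuous_map (gelfand_topology X A) (product_topology (\<lambda>_. euclideanreal) UNIV) id"
      by (simp add: continuous_map_componentwise_UNIV)
    then show ?thesis
      using top by (simp add: continuous_map_in_subtopology euclidean_product_topology)
  qed
  ultimately show ?thesis
    using top by (metis topology_eq topology_finer_continuous_id topspace_euclidean_subtopology)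
qed

lemma eval_at_in_gelfand_spectrum:
  assumes x: "x \<in> X"
  shows "eval_at A x \<in> gelfand_spectrum X A"
proof -
  have "linear_functional X A (eval_at A x)"
    unfolding linear_functional_def eval_at_def using x by (simp add: A_add A_scale)
  moreover have "\<forall>a\<in>A. \<forall>b\<in>A. eval_at A x (\<lambda>x\<in>X. a x * b x) = eval_at A x a * eval_at A x b"
    unfolding eval_at_def using x by (simp add: A_mult)
  moreover have "eval_at A x (\<lambda>x\<in>X. 1) = 1"
    unfolding eval_at_def using x A_const[of 1] by (simp only: restrict_apply if_True)
  moreover have "\<forall>a\<in>A. \<bar>eval_at A x a\<bar> \<le> sup_norm X a"
    using abs_le_sup_norm[OF _ x] by (simp add: eval_at_def)
  moreover have "\<forall>a. a \<notin> A \<longrightarrow> eval_at A x a = undefined"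
    by (simp add: eval_at_def)
  ultimately show ?thesis
    unfolding gelfand_spectrum_iff unital_algebra_hom_def by (intro conjI)
qed

definition transform_of :: "('x \<Rightarrow> real) \<Rightarrow> ((('x \<Rightarrow> real) \<Rightarrow> real) \<Rightarrow> real) \<Rightarrow> bool" where
  "transform_of a f \<longleftrightarrow> a \<in> A \<and> (\<forall>\<alpha>\<in>gelfand_spectrum X A. f \<alpha> = \<alpha> a)"

text \<open>Membership is required to depend only on the values on the spectrum: the transforms as total
  functions on \<open>('x \<Rightarrow> real) \<Rightarrow> real\<close> are not closed under multiplication.\<close>

definition transforms :: "((('x \<Rightarrow> real) \<Rightarrow> real) \<Rightarrow> real) set" where
  "transforms = {f. \<exists>a. transform_of a f}"

lemma transform_of_gelfand_transform: "a \<in> A \<Longrightarrow> transform_of a (gelfand_transform a)"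
  by (simp add: transform_of_def gelfand_transform_def)

lemma character_simps:
  assumes "\<alpha> \<in> gelfand_spectrum X A"
  shows "a \<in> A \<Longrightarrow> b \<in> A \<Longrightarrow> \<alpha> (\<lambda>x\<in>X. a x + b x) = \<alpha> a + \<alpha> b"
    and "a \<in> A \<Longrightarrow> \<alpha> (\<lambda>x\<in>X. c * a x) = c * \<alpha> a"
    and "a \<in> A \<Longrightarrow> b \<in> A \<Longrightarrow> \<alpha> (\<lambda>x\<in>X. a x * b x) = \<alpha> a * \<alpha> b"
    and "\<alpha> (\<lambda>x\<in>X. c) = c"
proof -
  have hom: "unital_algebra_hom X A \<alpha>" using assms by (simp add: gelfand_spectrum_def)
  show "a \<in> A \<Longrightarrow> b \<in> A \<Longrightarrow> \<alpha> (\<lambda>x\<in>X. a x + b x) = \<alpha> a + \<alpha> b"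
    and "a \<in> A \<Longrightarrow> b \<in> A \<Longrightarrow> \<alpha> (\<lambda>x\<in>X. a x * b x) = \<alpha> a * \<alpha> b"
    using hom unfolding unital_algebra_hom_def linear_functional_def by blast+
  show scale: "a \<in> A \<Longrightarrow> \<alpha> (\<lambda>x\<in>X. c * a x) = c * \<alpha> a" for c a
    using hom unfolding unital_algebra_hom_def linear_functional_def by blast
  have "(\<lambda>x\<in>X. c * (\<lambda>x\<in>X. 1) x) = (\<lambda>x\<in>X. c)" by (rule ext) simp
  then show "\<alpha> (\<lambda>x\<in>X. c) = c"
    using scale[OF A_const[of 1], of c] hom by (simp only: unital_algebra_hom_def mult_1_right)
qed

lemma transform_of_const: "transform_of (\<lambda>x\<in>X. c) (\<lambda>_. c)"
  unfolding transform_of_def by (intro conjI ballI A_const character_simps(4)[symmetric])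

lemma transform_of_add:
  "transform_of a f \<Longrightarrow> transform_of b g \<Longrightarrow> transform_of (\<lambda>x\<in>X. a x + b x) (\<lambda>x. f x + g x)"
  unfolding transform_of_def using A_add[of a b] character_simps(1)[of _ a b] by simp

lemma transform_of_scale:
  "transform_of a f \<Longrightarrow> transform_of (\<lambda>x\<in>X. c * a x) (\<lambda>x. c * f x)"
  unfolding transform_of_def using A_scale[of a c] character_simps(2)[of _ a c] by simp

lemma transform_of_mult:
  "transform_of a f \<Longrightarrow> transform_of b g \<Longrightarrow> transform_of (\<lambda>x\<in>X. a x * b x) (\<lambda>x. f x * g x)"
  unfolding transform_of_def using A_mult[of a b] character_simps(3)[of _ a b] by simp

lemma continuous_on_transform_of:
  assumes "transform_of a f"
  shows "continuous_on (gelfand_spectrum X A) f"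
proof -
  have "continuous_on (gelfand_spectrum X A) (\<lambda>\<alpha>. \<alpha> a)"
    by (rule continuous_on_subset[OF continuous_on_product_coordinates]) simp
  then show ?thesis
    by (rule continuous_on_eq) (use assms in \<open>simp add: transform_of_def\<close>)
qed

lemma transforms_separate:
  assumes "\<alpha> \<in> gelfand_spectrum X A" "\<beta> \<in> gelfand_spectrum X A" "\<alpha> \<noteq> \<beta>"
  shows "\<exists>f\<in>transforms. f \<alpha> \<noteq> f \<beta>"
proof -
  have "\<exists>a\<in>A. \<alpha> a \<noteq> \<beta> a"
  proof (rule ccontr)
    assume "\<not> (\<exists>a\<in>A. \<alpha> a \<noteq> \<beta> a)"
    then have "\<alpha> a = \<beta> a" for a using assms(1,2) by (cases "a \<in> A") (auto simp: gelfand_spectrum_iff)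
    then show False using assms(3) by auto
  qed
  then obtain a where a: "a \<in> A" "\<alpha> a \<noteq> \<beta> a" by blast
  then have "gelfand_transform a \<in> transforms"
    using transform_of_gelfand_transform by (auto simp: transforms_def)
  with a(2) show ?thesis by (intro bexI[of _ "gelfand_transform a"]) (simp_all add: gelfand_transform_def)
qed

sublocale function_ring_on transforms "gelfand_spectrum X A"
proof
  show "compact (gelfand_spectrum X A)" by (rule compact_gelfand_spectrum)
  show "continuous_on (gelfand_spectrum X A) f" if "f \<in> transforms" for f
    using that continuous_on_transform_of unfolding transforms_def by blast
  show "(\<lambda>x. f x + g x) \<in> transforms" if "f \<in> transforms" "g \<in> transforms" for f g
    using that transform_of_add unfolding transforms_def by blast
  show "(\<lambda>x. f x * g x) \<in> transforms" if "f \<in> transforms" "g \<in> transforms" for f g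
    using that transform_of_mult unfolding transforms_def by blast
  show "(\<lambda>_. c) \<in> transforms" for c
    using transform_of_const unfolding transforms_def by blast
qed (rule transforms_separate)

definition lift_functional :: "(('x \<Rightarrow> real) \<Rightarrow> real) \<Rightarrow> ((('x \<Rightarrow> real) \<Rightarrow> real) \<Rightarrow> real) \<Rightarrow> real" where
  "lift_functional L f = L (\<lambda>x\<in>X. f (eval_at A x))"

lemma lift_functional_eq:
  assumes "transform_of a f"
  shows "lift_functional L f = L a"
proof -
  have a: "a \<in> A" "\<forall>\<alpha>\<in>gelfand_spectrum X A. f \<alpha> = \<alpha> a"
    using assms by (simp_all add: transform_of_def)
  have "(\<lambda>x\<in>X. f (eval_at A x)) = (\<lambda>x\<in>X. a x)"
    by (rule restrict_ext) (simp add: a eval_at_in_gelfand_spectrum, simp add: a eval_at_def)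
  then show ?thesis unfolding lift_functional_def by (simp only: A_restrict[OF a(1)])
qed

lemma dense_positive_functional_lift:
  assumes lin: "linear_functional X A L" and pos: "positive_functional X A L"
  shows "dense_positive_functional (gelfand_topology X A) transforms (lift_functional L)"
  unfolding gelfand_topology_eq
proof
  let ?S = "gelfand_spectrum X A"
  show "compact_space (top_of_set ?S)"
    using compact_gelfand_spectrum by (simp add: compact_space_subtopology)
  show "Hausdorff_space (top_of_set ?S)"
    unfolding Hausdorff_space_def
  proof (intro allI impI)
    fix \<alpha> \<beta>
    assume ab: "\<alpha> \<in> topspace (top_of_set ?S) \<and> \<beta> \<in> topspace (top_of_set ?S) \<and> \<alpha> \<noteq> \<beta>"
    then obtain U V where UV: "open U" "open V" "\<alpha> \<in> U" "\<beta> \<in> V" "U \<inter> V = {}"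
      using hausdorff by metis
    then show "\<exists>U V. openin (top_of_set ?S) U \<and> openin (top_of_set ?S) V \<and>
        \<alpha> \<in> U \<and> \<beta> \<in> V \<and> disjnt U V"
      using ab by (intro exI[of _ "?S \<inter> U"] exI[of _ "?S \<inter> V"]) (auto simp: disjnt_def)
  qed
  show "continuous_map (top_of_set ?S) euclideanreal f" if "f \<in> transforms" for f
    using continuous[OF that] by simp
  show "\<exists>g\<in>transforms. \<forall>\<alpha>\<in>topspace (top_of_set ?S). \<bar>f \<alpha> - g \<alpha>\<bar> < e"
    if "continuous_map (top_of_set ?S) euclideanreal f" "0 < e" for f e
    using Stone_Weierstrass_basic[of f e] that by simp
  show "(\<lambda>_. c) \<in> transforms" for c by (rule const)
  show "(\<lambda>x. f x + g x) \<in> transforms" if "f \<in> transforms" "g \<in> transforms" for f g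
    using that by (rule add)
  show "(\<lambda>x. c * f x) \<in> transforms" if "f \<in> transforms" for c f
    using const that by (rule mult)
  show "lift_functional L (\<lambda>x. f x + g x) = lift_functional L f + lift_functional L g"
    if fg: "f \<in> transforms" "g \<in> transforms" for f g
  proof -
    obtain a b where a: "transform_of a f" and b: "transform_of b g"
      using fg unfolding transforms_def by blast
    have "L (\<lambda>x\<in>X. a x + b x) = L a + L b"
      using lin a b unfolding linear_functional_def transform_of_def by blast
    then show ?thesis
      by (simp only: lift_functional_eq[OF a] lift_functional_eq[OF b]
          lift_functional_eq[OF transform_of_add[OF a b]])
  qed
  show "lift_functional L (\<lambda>x. c * f x) = c * lift_functional L f" if f: "f \<in> transforms" for c f
  proof -
    obtain a where a: "transform_of a f" using f unfolding transforms_def by blast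
    have "L (\<lambda>x\<in>X. c * a x) = c * L a"
      using lin a unfolding linear_functional_def transform_of_def by blast
    then show ?thesis
      by (simp only: lift_functional_eq[OF a] lift_functional_eq[OF transform_of_scale[OF a]])
  qed
  show "0 \<le> lift_functional L f"
    if f: "f \<in> transforms" and nn: "\<And>\<alpha>. \<alpha> \<in> topspace (top_of_set ?S) \<Longrightarrow> 0 \<le> f \<alpha>" for f
  proof -
    obtain a where a: "transform_of a f" using f unfolding transforms_def by blast
    have "0 \<le> a x" if "x \<in> X" for x
    proof -
      have "f (eval_at A x) = a x"
        using a eval_at_in_gelfand_spectrum[OF that] unfolding transform_of_def
        by (simp add: eval_at_def)
      then show ?thesis using nn[of "eval_at A x"] eval_at_in_gelfand_spectrum[OF that] by simp
    qed
    then have "0 \<le> L a" using pos a unfolding positive_functional_def transform_of_def by blast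
    then show ?thesis by (simp only: lift_functional_eq[OF a])
  qed
qed

lemma represents_transforms_iff:
  assumes "radon_measure (gelfand_topology X A) M"
  shows "(\<forall>f\<in>transforms. integrable M f \<and> integral\<^sup>L M f = lift_functional L f) \<longleftrightarrow>
    (\<forall>a\<in>A. integrable M (gelfand_transform a) \<and> L a = integral\<^sup>L M (gelfand_transform a))"
proof -
  have "topspace (gelfand_topology X A) = gelfand_spectrum X A"
    by (simp add: gelfand_topology_eq)
  moreover have "sets M = sets (sigma (topspace (gelfand_topology X A)) {U. openin (gelfand_topology X A) U})"
    using assms by (simp add: radon_measure_def)
  ultimately have space_M: "space M = gelfand_spectrum X A"
    using sets_eq_imp_space_eq by (metis space_measure_of_conv)
  show ?thesis
  proof (intro iffI ballI)
    fix a assume a: "a \<in> A"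
      and *: "\<forall>f\<in>transforms. integrable M f \<and> integral\<^sup>L M f = lift_functional L f"
    have tr: "transform_of a (gelfand_transform a)" by (rule transform_of_gelfand_transform[OF a])
    then have "gelfand_transform a \<in> transforms" unfolding transforms_def by blast
    then show "integrable M (gelfand_transform a) \<and> L a = integral\<^sup>L M (gelfand_transform a)"
      using * by (simp add: lift_functional_eq[OF tr])
  next
    fix f assume f: "f \<in> transforms"
      and *: "\<forall>a\<in>A. integrable M (gelfand_transform a) \<and> L a = integral\<^sup>L M (gelfand_transform a)"
    obtain a where tr: "transform_of a f" using f unfolding transforms_def by blast
    then have a: "a \<in> A" "\<forall>\<alpha>\<in>gelfand_spectrum X A. f \<alpha> = \<alpha> a"
      by (simp_all add: transform_of_def)
    have "integrable M f \<longleftrightarrow> integrable M (gelfand_transform a)"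
      by (rule Bochner_Integration.integrable_cong) (simp_all add: space_M a gelfand_transform_def)
    moreover have "integral\<^sup>L M f = integral\<^sup>L M (gelfand_transform a)"
      by (rule Bochner_Integration.integral_cong) (simp_all add: space_M a gelfand_transform_def)
    ultimately show "integrable M f \<and> integral\<^sup>L M f = lift_functional L f"
      using * a(1) by (simp add: lift_functional_eq[OF tr])
  qed
qed

end

theorem mainTheorem4:
  fixes X :: "'x set" and A :: "('x \<Rightarrow> real) set" and L :: "('x \<Rightarrow> real) \<Rightarrow> real"
  assumes "X \<noteq> {}"
    and "unital_subalgebra X A"
    and "linear_functional X A L"
    and "positive_functional X A L"
    and "continuous_map (sup_topology X A) euclideanreal L"
  shows "\<exists>!M. radon_measure (gelfand_topology X A) M \<and>
    (\<forall>a\<in>A. integrable M (gelfand_transform a) \<and>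
      L a = integral\<^sup>L M (gelfand_transform a))"
proof -
  interpret bounded_function_algebra X A by standard (fact assms)+
  interpret dense_positive_functional "gelfand_topology X A" transforms "lift_functional L"
    by (rule dense_positive_functional_lift) (fact assms)+
  have "radon_measure (gelfand_topology X A) M \<and>
      (\<forall>f\<in>transforms. integrable M f \<and> integral\<^sup>L M f = lift_functional L f) \<longleftrightarrow>
    radon_measure (gelfand_topology X A) M \<and>
      (\<forall>a\<in>A. integrable M (gelfand_transform a) \<and> L a = integral\<^sup>L M (gelfand_transform a))" for M
    using represents_transforms_iff[of M L] by blast
  then show ?thesis using ex1_representing_measure by (simp only:)
qed

end
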